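(* The map $\mathcal{I}_{PV}:\mathbb{RP}^2_P\to\mathbb{RP}^2_V$ from the extended Euclidean plane to the vector space construction of the real projective plane is an isomorphism.
   Context: Extended Euclidean plane: $\mathbb{RP}^2_P=\mathbb{R}^2\cup\ell_{\infty,P}$, where $\ell_{\infty,P}=\{(m)\mid m\in\mathbb{R}\cup\{\infty\}\}$ is a set of additional formal points, one for each slope $m\in\mathbb{R}\cup\{\infty\}$, disjoint from $\mathbb{R}^2$. Its lines are: the sets $\{(x,mx+b)\mid x\in\mathbb{R}\}\cup\{(m)\}$ for $m,b\in\mathbb{R}$; the vertical lines $\{(c,y)\mid y\in\mathbb{R}\}\cup\{(\infty)\}$ for $c\in\mathbb{R}$; and the line at infinity $\ell_{\infty,P}$. Vector space construction: the points of $\mathbb{RP}^2_V$ are the 1-dimensional linear subspaces of $\mathbb{R}^3$ and its lines are the 2-dimensional linear subspaces of $\mathbb{R}^3$; a point is incident with (lies on) a line if it is contained in it, and a line is identified with the set of points incident with it. An isomorphism is a bijection from the points of one plane to the points of the other such that for every line $\ell$ of the first plane, the set of images of the points of $\ell$ is (the set of points of) a line of the second. The map $\mathcal{I}_{PV}$: $\mathcal{I}_{PV}((x,y))=\mathrm{span}(\langle x,y,1\rangle)$ for $(x,y)\in\mathbb{R}^2$; $\mathcal{I}_{PV}((m))=\mathrm{span}(\langle 1,m,0\rangle)$ for $m\in\mathbb{R}$; $\mathcal{I}_{PV}((\infty))=\mathrm{span}(\langle 0,1,0\rangle)$. *)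

theory Defs
  imports "HOL-Analysis.Analysis"
begin

text \<open>A plane is a pair consisting of its set of points and its set of lines,
  where a line is identified with the set of points incident with it.\<close>

type_synonym 'a plane = "'a set \<times> 'a set set"

definition plane_isomorphism :: "('a \<Rightarrow> 'b) \<Rightarrow> 'a plane \<Rightarrow> 'b plane \<Rightarrow> bool" where
  "plane_isomorphism f A B \<longleftrightarrow>
     bij_betw f (fst A) (fst B) \<and> (\<forall>l \<in> snd A. f ` l \<in> snd B)"

datatype slope = Slope real | Infinite_Slope

datatype ext_point = Affine real real | At_Infinity slope

definition sloped_line :: "real \<Rightarrow> real \<Rightarrow> ext_point set" where
  "sloped_line m b = {Affine x (m * x + b) | x. True} \<union> {At_Infinity (Slope m)}"

definition vertical_line :: "real \<Rightarrow> ext_point set" where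
  "vertical_line c = {Affine c y | y. True} \<union> {At_Infinity Infinite_Slope}"

definition line_at_infinity :: "ext_point set" where
  "line_at_infinity = {At_Infinity s | s. True}"

definition RP2_P :: "ext_point plane" where
  "RP2_P =
     (UNIV,
      {sloped_line m b | m b. True} \<union> {vertical_line c | c. True} \<union> {line_at_infinity})"

definition V_points :: "(real^3) set set" where
  "V_points = {p. subspace p \<and> dim p = 1}"

definition V_points_on :: "(real^3) set \<Rightarrow> (real^3) set set" where
  "V_points_on L = {p \<in> V_points. p \<subseteq> L}"

definition RP2_V :: "(real^3) set plane" where
  "RP2_V = (V_points, {V_points_on L | L. subspace L \<and> dim L = 2})"

fun I_PV :: "ext_point \<Rightarrow> (real^3) set" where
  "I_PV (Affine x y) = span {vector [x, y, 1]}"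
| "I_PV (At_Infinity (Slope m)) = span {vector [1, m, 0]}"
| "I_PV (At_Infinity Infinite_Slope) = span {vector [0, 1, 0]}"

end

theory Submission
  imports Defs
begin

text \<open>Every point maps to the span of its homogeneous coordinates, and every nonzero
  vector of \<open>\<real>\<^sup>3\<close> is a nonzero multiple of the homogeneous coordinates of exactly one
  point; this gives bijectivity. Each line consists of the points whose homogeneous
  coordinates are orthogonal to a fixed nonzero vector \<open>n\<close>, so its image is the set of
  points on the plane orthogonal to \<open>n\<close>.\<close>

text \<open>One normalized generator per point, so that incidence becomes a linear equation on
  vectors.\<close>

fun hom_coords :: "ext_point \<Rightarrow> real^3" where
  "hom_coords (Affine x y) = vector [x, y, 1]"
| "hom_coords (At_Infinity (Slope m)) = vector [1, m, 0]"
| "hom_coords (At_Infinity Infinite_Slope) = vector [0, 1, 0]"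

lemma I_PV_eq_span_hom_coords: "I_PV p = span {hom_coords p}"
  by (cases p rule: hom_coords.cases) auto

lemma hom_coords_nonzero: "hom_coords p \<noteq> 0"
  by (cases p rule: hom_coords.cases) (auto simp: vec_eq_iff forall_3)

text \<open>For points of the same kind, a coordinate that is 1 on both sides forces
  \<open>c = 1\<close>. For points of different kinds, either some coordinate gives 1 = 0, or
  \<open>c = 0\<close>, which contradicts the entry 1 in \<open>hom_coords p\<close>.\<close>

lemma hom_coords_parallel_imp_eq:
  assumes "hom_coords p = c *\<^sub>R hom_coords q"
  shows "p = q"
  using assms
  by (cases p rule: hom_coords.cases; cases q rule: hom_coords.cases)
    (auto simp: vec_eq_iff forall_3)

text \<open>Divide by the third coordinate if it is nonzero, else by the first, else by the second;
  these cases match the three kinds of points.\<close>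

lemma exists_hom_coords:
  fixes v :: "real^3"
  assumes "v \<noteq> 0"
  shows "\<exists>p c. c \<noteq> 0 \<and> v = c *\<^sub>R hom_coords p"
proof -
  consider "v$3 \<noteq> 0" | "v$3 = 0" "v$1 \<noteq> 0" | "v$3 = 0" "v$1 = 0" "v$2 \<noteq> 0"
    using assms by (auto simp: vec_eq_iff forall_3)
  then show ?thesis
  proof cases
    case 1
    then have "v = (v$3) *\<^sub>R hom_coords (Affine (v$1 / v$3) (v$2 / v$3))"
      by (simp add: vec_eq_iff forall_3)
    with 1 show ?thesis by blast
  next
    case 2
    then have "v = (v$1) *\<^sub>R hom_coords (At_Infinity (Slope (v$2 / v$1)))"
      by (simp add: vec_eq_iff forall_3)
    with 2 show ?thesis by blast
  next
    case 3
    then have "v = (v$2) *\<^sub>R hom_coords (At_Infinity Infinite_Slope)"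
      by (simp add: vec_eq_iff forall_3)
    with 3 show ?thesis by blast
  qed
qed

lemma inj_I_PV: "inj I_PV"
proof (rule injI)
  fix p q
  assume "I_PV p = I_PV q"
  then have "hom_coords p \<in> span {hom_coords q}"
    by (metis I_PV_eq_span_hom_coords insertI1 span_base)
  then show "p = q"
    by (auto simp: span_singleton intro: hom_coords_parallel_imp_eq)
qed

lemma V_points_eq_span:
  assumes "P \<in> V_points"
  shows "\<exists>v. v \<noteq> 0 \<and> P = span {v}"
proof -
  from assms have P: "subspace P" "dim P = 1"
    by (auto simp: V_points_def)
  obtain B where B: "B \<subseteq> P" "independent B" "P \<subseteq> span B" "card B = dim P"
    using basis_exists by blast
  with P obtain v where "B = {v}"
    by (metis card_1_singletonE)
  \<comment> \<open>A set containing 0 is dependent, so a basis vector is nonzero.\<close>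
  moreover from this B have "v \<noteq> 0"
    using dependent_zero by auto
  moreover have "P = span B"
    using B P by (simp add: span_minimal subset_antisym)
  ultimately show ?thesis by auto
qed

lemma span_in_V_points:
  assumes "v \<noteq> 0"
  shows "span {v} \<in> V_points"
  using assms by (simp add: V_points_def dim_singleton)

lemma range_I_PV: "range I_PV = V_points"
proof
  show "range I_PV \<subseteq> V_points"
    using hom_coords_nonzero by (auto simp: I_PV_eq_span_hom_coords intro!: span_in_V_points)
  show "V_points \<subseteq> range I_PV"
  proof
    fix P
    assume "P \<in> V_points"
    then obtain v where v: "v \<noteq> 0" "P = span {v}"
      using V_points_eq_span by blast
    then obtain p c where "c \<noteq> 0" "v = c *\<^sub>R hom_coords p"
      using exists_hom_coords by blast
    with v have "P = I_PV p"
      using span_image_scale[of "{hom_coords p}" "\<lambda>_. c"]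
      by (simp add: I_PV_eq_span_hom_coords)
    then show "P \<in> range I_PV" by blast
  qed
qed

text \<open>A subspace contains a span iff it contains the generator.\<close>

lemma image_I_PV_orthogonal_is_line:
  assumes "n \<noteq> 0" and l: "l = {p. n \<bullet> hom_coords p = 0}"
  shows "I_PV ` l \<in> snd RP2_V"
proof -
  let ?L = "{v. n \<bullet> v = 0}"
  have subsp: "subspace ?L"
    by (rule subspace_hyperplane)
  have "I_PV p \<subseteq> ?L \<longleftrightarrow> p \<in> l" for p
    unfolding I_PV_eq_span_hom_coords l
    using span_minimal[OF _ subsp, of "{hom_coords p}"] span_base[of "hom_coords p" "{hom_coords p}"]
    by auto
  \<comment> \<open>Surjectivity enters here: every point inside \<open>?L\<close> is some
    \<open>I_PV p\<close>, and then \<open>p\<close> lies in \<open>l\<close>.\<close>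
  then have "I_PV ` l = V_points_on ?L"
    unfolding V_points_on_def range_I_PV[symmetric] by auto
  moreover have "dim ?L = 2"
    using assms by (simp add: dim_hyperplane)
  ultimately show ?thesis
    using subsp by (auto simp: RP2_V_def)
qed

text \<open>The vector \<open>n\<close> holds the coefficients of the homogenized line equation:
  \<open>m*x - y + b*z = 0\<close>, \<open>x - c*z = 0\<close> or \<open>z = 0\<close>. Setting
  \<open>z = 0\<close> in the first two leaves just the point at infinity of the respective
  line.\<close>

lemma line_eq_orthogonal:
  assumes "l \<in> snd RP2_P"
  shows "\<exists>n. n \<noteq> 0 \<and> l = {p. n \<bullet> hom_coords p = 0}"
proof -
  have inner: "(vector [a, b, c] :: real^3) \<bullet> vector [x, y, z] = a * x + b * y + c * z"
    for a b c x y z :: real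
    by (simp add: inner_vec_def sum_3)
  have nonzero: "(vector [a, b, c] :: real^3) \<noteq> 0 \<longleftrightarrow> a \<noteq> 0 \<or> b \<noteq> 0 \<or> c \<noteq> 0" for a b c :: real
    by (auto simp: vec_eq_iff forall_3)
  consider m b where "l = sloped_line m b" | c where "l = vertical_line c" | "l = line_at_infinity"
    using assms by (auto simp: RP2_P_def)
  then show ?thesis
  proof cases
    case 1
    have "p \<in> l \<longleftrightarrow> vector [m, -1, b] \<bullet> hom_coords p = 0" for p
      by (cases p rule: hom_coords.cases) (auto simp: 1 sloped_line_def inner)
    then show ?thesis
      by (intro exI[of _ "vector [m, -1, b]"]) (auto simp: nonzero)
  next
    case 2
    have "p \<in> l \<longleftrightarrow> vector [1, 0, -c] \<bullet> hom_coords p = 0" for p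
      by (cases p rule: hom_coords.cases) (auto simp: 2 vertical_line_def inner)
    then show ?thesis
      by (intro exI[of _ "vector [1, 0, -c]"]) (auto simp: nonzero)
  next
    case 3
    have "p \<in> l \<longleftrightarrow> vector [0, 0, 1] \<bullet> hom_coords p = 0" for p
      by (cases p rule: hom_coords.cases) (auto simp: 3 line_at_infinity_def inner)
    then show ?thesis
      by (intro exI[of _ "vector [0, 0, 1]"]) (auto simp: nonzero)
  qed
qed

theorem theorem4p3:
  shows "plane_isomorphism I_PV RP2_P RP2_V"
proof -
  have "bij_betw I_PV (fst RP2_P) (fst RP2_V)"
    using inj_I_PV range_I_PV by (simp add: bij_betw_def RP2_P_def RP2_V_def)
  then show ?thesis
    unfolding plane_isomorphism_def
    using line_eq_orthogonal image_I_PV_orthogonal_is_line by blast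
qed

end
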